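(* Let $r,s\ge 1$ be integers, let $b\in\mathbb{C}\setminus\{0\}$, and put $$u_0=y,\qquad u_1=x-b x^{r}y^{s}.$$ Let $F=(F_1,F_2):\mathbb{C}^2\to\mathbb{C}^2$ be a polynomial map such that each of $F_1$ and $F_2$ can be written as a finite sum $$\sum_{\alpha,\beta}a_{\alpha\beta}\,u_0^{\alpha}u_1^{\beta},\qquad a_{\alpha\beta}\in\mathbb{C}$$ (with nonnegative integer exponents $\alpha,\beta$ and with coefficients depending on the component). Then $F$ satisfies the Jacobian conjecture.
   Context: A polynomial map $F:\mathbb{C}^2\to\mathbb{C}^2$ satisfies the Jacobian condition if there is a constant $c\in\mathbb{C}\setminus\{0\}$ such that $\det JF(x,y)=c$ for all $(x,y)\in\mathbb{C}^2$, where $JF(x,y)$ is the Jacobian matrix of $F$ at $(x,y)$. One says that $F$ satisfies the Jacobian conjecture if the following implication holds: if $F$ satisfies the Jacobian condition, then $F$ is a polynomial automorphism of $\mathbb{C}^2$ (a bijective polynomial map with polynomial inverse). *)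

theory Defs
  imports "HOL-Analysis.Analysis"
begin

definition polynomial_function2 :: "(complex^2 \<Rightarrow> complex) \<Rightarrow> bool" where
  "polynomial_function2 f \<longleftrightarrow>
     (\<exists>(I :: (nat \<times> nat) set) a. finite I \<and>
        (\<forall>p. f p = (\<Sum>(\<alpha>, \<beta>)\<in>I. a \<alpha> \<beta> * (p $ 1) ^ \<alpha> * (p $ 2) ^ \<beta>)))"

definition polynomial_map :: "(complex^2 \<Rightarrow> complex^2) \<Rightarrow> bool" where
  "polynomial_map F \<longleftrightarrow> (\<forall>i. polynomial_function2 (\<lambda>p. F p $ i))"

(* The Frechet derivative at p of a polynomial map is complex linear, and its value at
   axis j 1 is the j-th complex partial derivative; so jacobian F (at p) is the matrix
   of complex partial derivatives, although frechet_derivative is a real notion. *)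
definition jacobian_condition :: "(complex^2 \<Rightarrow> complex^2) \<Rightarrow> bool" where
  "jacobian_condition F \<longleftrightarrow> (\<exists>c. c \<noteq> 0 \<and> (\<forall>p. det (jacobian F (at p)) = c))"

definition polynomial_automorphism :: "(complex^2 \<Rightarrow> complex^2) \<Rightarrow> bool" where
  "polynomial_automorphism F \<longleftrightarrow> polynomial_map F \<and> bij F \<and> polynomial_map (inv F)"

definition satisfies_jacobian_conjecture :: "(complex^2 \<Rightarrow> complex^2) \<Rightarrow> bool" where
  "satisfies_jacobian_conjecture F \<longleftrightarrow> (jacobian_condition F \<longrightarrow> polynomial_automorphism F)"

end

theory Submission
  imports Defs
begin

text \<open>
  The Jacobian condition is never met, so the implication holds vacuously. A map whose components
  are polynomials in \<open>u0 = y\<close> and \<open>u1 = x - b x\<^sup>r y\<^sup>s\<close> factors through \<open>(u0, u1)\<close>, so by the chain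
  rule its Jacobian determinant vanishes wherever that of \<open>(u0, u1)\<close> does. Up to sign the latter
  is \<open>1 - r b x\<^bsup>r-1\<^esup> y\<^sup>s\<close>, a nonconstant polynomial because \<open>r, s \<ge> 1\<close> and \<open>b \<noteq> 0\<close>; over the complex
  numbers it has a zero, for instance \<open>(1, t)\<close> with \<open>r b t\<^sup>s = 1\<close>.

  At such a point the partial derivatives of both \<open>u0\<close> and \<open>u1\<close> in the direction of \<open>x\<close> are zero.
  Vanishing of the derivative in a fixed direction is inherited by every polynomial expression
  (lemma \<open>stationary_along_polynomial\<close>), so a whole column of the Jacobian matrix is zero there
  (lemma \<open>det_jacobian_eq_0\<close>).
\<close>

text \<open>
  The derivative is existentially quantified so that differentiability and the vanishing of the
  directional derivative travel together through the closure lemmas below.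
\<close>

definition stationary_along ::
    "'a::real_normed_vector \<Rightarrow> 'a \<Rightarrow> ('a \<Rightarrow> 'b::real_normed_vector) \<Rightarrow> bool" where
  "stationary_along h p f \<longleftrightarrow> (\<exists>f'. (f has_derivative f') (at p) \<and> f' h = 0)"

lemma stationary_along_const: "stationary_along h p (\<lambda>x. c)"
  unfolding stationary_along_def by (intro exI[of _ "\<lambda>_. 0"]) auto

lemma stationary_along_mult:
  fixes f g :: "'a::real_normed_vector \<Rightarrow> 'b::real_normed_algebra"
  assumes "stationary_along h p f" and "stationary_along h p g"
  shows "stationary_along h p (\<lambda>x. f x * g x)"
proof -
  obtain f' g' where "(f has_derivative f') (at p)" "f' h = 0"
      and "(g has_derivative g') (at p)" "g' h = 0"
    using assms unfolding stationary_along_def by blast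
  then show ?thesis
    unfolding stationary_along_def
    by (intro exI[of _ "\<lambda>k. f p * g' k + f' k * g p"]) (auto intro: has_derivative_mult)
qed

lemma stationary_along_power:
  fixes f :: "'a::real_normed_vector \<Rightarrow> 'b::real_normed_algebra_1"
  assumes "stationary_along h p f"
  shows "stationary_along h p (\<lambda>x. f x ^ n)"
  by (induction n) (auto intro: stationary_along_const stationary_along_mult assms)

lemma stationary_along_sum:
  assumes "\<And>i. i \<in> I \<Longrightarrow> stationary_along h p (f i)"
  shows "stationary_along h p (\<lambda>x. \<Sum>i\<in>I. f i x)"
proof -
  have "\<forall>i\<in>I. \<exists>D. (f i has_derivative D) (at p) \<and> D h = 0"
    using assms unfolding stationary_along_def by blast
  from bchoice[OF this] obtain f' where
    "\<And>i. i \<in> I \<Longrightarrow> (f i has_derivative f' i) (at p) \<and> f' i h = 0"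
    by blast
  then show ?thesis
    unfolding stationary_along_def
    by (intro exI[of _ "\<lambda>k. \<Sum>i\<in>I. f' i k"]) (auto intro!: has_derivative_sum)
qed

text \<open>
  This takes the place of the chain rule for a map factoring through \<open>(u, v)\<close>: if the derivative
  of \<open>(u, v)\<close> annihilates a direction, so does that of the composition.
\<close>

lemma stationary_along_polynomial:
  fixes u v :: "'a::real_normed_vector \<Rightarrow> 'b::real_normed_algebra_1"
  assumes "stationary_along h p u" and "stationary_along h p v"
  shows "stationary_along h p (\<lambda>x. \<Sum>(\<alpha>, \<beta>)\<in>I. a \<alpha> \<beta> * u x ^ \<alpha> * v x ^ \<beta>)"
  unfolding case_prod_beta
  by (intro stationary_along_sum stationary_along_mult stationary_along_power
      stationary_along_const assms)

text \<open>
  The map is the sum of its components placed on their axes, and placing a vector on an axis is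
  bounded linear, so the derivative can be assembled from those of the components.
\<close>

lemma stationary_along_vec:
  fixes F :: "'a::real_normed_vector \<Rightarrow> 'b::real_normed_vector ^ 'n"
  assumes "\<And>i. stationary_along h p (\<lambda>x. F x $ i)"
  shows "stationary_along h p F"
proof -
  have "\<forall>i. \<exists>D. ((\<lambda>x. F x $ i) has_derivative D) (at p) \<and> D h = 0"
    using assms unfolding stationary_along_def by blast
  from choice[OF this] obtain D where
    D: "\<And>i. ((\<lambda>x. F x $ i) has_derivative D i) (at p)" "\<And>i. D i h = 0"
    by blast
  have axis_linear: "bounded_linear (axis i :: 'b \<Rightarrow> 'b ^ 'n)" for i
  proof (rule bounded_linear_intro[of _ 1])
    show "norm (axis i x :: 'b ^ 'n) \<le> norm x * 1" for x
      by (simp add: axis_def norm_vec_def L2_set_def if_distrib[of norm]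
          if_distrib[of "\<lambda>y. y\<^sup>2"] cong: if_cong)
  qed (auto simp: vec_eq_iff axis_def)
  have "((\<lambda>x. \<Sum>i\<in>UNIV. axis i (F x $ i)) has_derivative (\<lambda>k. \<Sum>i\<in>UNIV. axis i (D i k))) (at p)"
    by (intro has_derivative_sum bounded_linear.has_derivative[OF axis_linear] D)
  moreover have "(\<lambda>x. \<Sum>i\<in>UNIV. axis i (F x $ i)) = F"
    by (auto simp: vec_eq_iff axis_def fun_eq_iff)
  moreover have "(\<Sum>i\<in>UNIV. axis i (D i h)) = 0"
    by (auto simp: vec_eq_iff axis_def D)
  ultimately show ?thesis
    unfolding stationary_along_def by auto
qed

text \<open>
  Column \<open>j\<close> of the Jacobian matrix is the value of the derivative at the \<open>j\<close>-th unit vector.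
\<close>

lemma det_jacobian_eq_0:
  fixes F :: "'a::real_normed_field ^ 'n \<Rightarrow> 'a ^ 'n"
  assumes "stationary_along (axis j 1) p F"
  shows "det (jacobian F (at p)) = 0"
proof (rule det_zero_column)
  have "frechet_derivative F (at p) (axis j 1) = 0"
    using assms unfolding stationary_along_def by (metis frechet_derivative_at)
  then show "column j (jacobian F (at p)) = 0"
    by (simp add: jacobian_def matrix_def column_def vec_eq_iff)
qed

theorem corollary2p21:
  fixes r s :: nat and b :: complex
    and u0 u1 :: "complex^2 \<Rightarrow> complex"
    and F :: "complex^2 \<Rightarrow> complex^2"
  assumes "r \<ge> 1" and "s \<ge> 1" and "b \<noteq> 0"
    and "u0 = (\<lambda>p. p $ 2)"
    and "u1 = (\<lambda>p. p $ 1 - b * (p $ 1) ^ r * (p $ 2) ^ s)"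
    and "polynomial_map F"
    and "\<forall>i. \<exists>(I :: (nat \<times> nat) set) a. finite I \<and>
           (\<forall>p. F p $ i = (\<Sum>(\<alpha>, \<beta>)\<in>I. a \<alpha> \<beta> * u0 p ^ \<alpha> * u1 p ^ \<beta>))"
  shows "satisfies_jacobian_conjecture F"
proof -
  \<comment> \<open>An \<open>s\<close>-th root of \<open>1 / (r b)\<close>, so that \<open>\<partial>u1/\<partial>x = 1 - r b x\<^bsup>r-1\<^esup> y\<^sup>s\<close> vanishes at \<open>(1, t)\<close>.\<close>
  define t :: complex where "t = exp (Ln (1 / (of_nat r * b)) / of_nat s)"
  have "t ^ s = exp (Ln (1 / (of_nat r * b)))"
    using \<open>s \<ge> 1\<close> by (simp add: t_def flip: exp_of_nat_mult)
  then have t: "of_nat r * b * t ^ s = 1"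
    using \<open>r \<ge> 1\<close> \<open>b \<noteq> 0\<close> by simp
  define p :: "complex^2" where "p = vector [1, t]"
  have p: "p $ 1 = 1" "p $ 2 = t"
    by (simp_all add: p_def)
  define h :: "complex^2" where "h = axis 1 1"
  have h: "h $ 1 = 1" "h $ 2 = 0"
    by (simp_all add: h_def axis_def)
  have coord: "((\<lambda>x::complex^2. x $ i) has_derivative (\<lambda>k. k $ i)) (at p)" for i
    by (rule bounded_linear.has_derivative[OF bounded_linear_vec_nth has_derivative_ident])
  have u0: "stationary_along h p u0"
    unfolding stationary_along_def \<open>u0 = _\<close> using coord h by blast
  define u1' where "u1' = (\<lambda>k::complex^2. k $ 1 -
      (b * p $ 1 ^ r * (of_nat s * k $ 2 * p $ 2 ^ (s - 1)) +
       b * (of_nat r * k $ 1 * p $ 1 ^ (r - 1)) * p $ 2 ^ s))"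
  have "(u1 has_derivative u1') (at p)"
    unfolding \<open>u1 = _\<close> u1'_def
    by (intro has_derivative_diff has_derivative_mult has_derivative_mult_right
        has_derivative_power coord)
  moreover have "u1' h = 0"
    using t by (simp add: u1'_def h p mult.commute)
  ultimately have u1: "stationary_along h p u1"
    unfolding stationary_along_def by blast
  have "stationary_along h p (\<lambda>x. F x $ i)" for i
  proof -
    obtain I :: "(nat \<times> nat) set" and a where
      "\<forall>x. F x $ i = (\<Sum>(\<alpha>, \<beta>)\<in>I. a \<alpha> \<beta> * u0 x ^ \<alpha> * u1 x ^ \<beta>)"
      using spec[OF assms(7), of i] by blast
    then show ?thesis
      using stationary_along_polynomial[OF u0 u1, of a I] by simp
  qed
  then have "det (jacobian F (at p)) = 0"
    unfolding h_def by (intro det_jacobian_eq_0 stationary_along_vec)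
  then show ?thesis
    unfolding satisfies_jacobian_conjecture_def jacobian_condition_def by auto
qed

end
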